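(* Let $f\in\operatorname{Sym}\mathscr P\langle\mathbf q,\bar{\mathbf q}\rangle$. Consider the problem of minimizing $f(\mathbf q,\bar{\mathbf q})$ over $K_{\mathbf g,\mathbf h}$ and one of the following two order-$d$ moment relaxations (defined in the context): (i) the relaxation (Mom-$\mathbb H$), when $g_i\in\operatorname{Sym}\mathbb R\langle\mathbf q,\bar{\mathbf q}\rangle$ ($i=1,\dots,m$) and $h_j\in\mathbb R\langle\mathbf q,\bar{\mathbf q}\rangle$ ($j=1,\dots,\ell$); (ii) the relaxation (Mom-$\mathbb H,\mathbb R$), when $g_i,h_j\in\operatorname{Sym}\mathscr P\langle\mathbf q,\bar{\mathbf q}\rangle$. Let $\mathbf y$ be an optimal solution of the corresponding relaxation. If $\operatorname{rank}_{\mathbb H}\mathbf M_d(\mathbf y)=1$, then the relaxation is tight (its optimal value equals $\inf_{K_{\mathbf g,\mathbf h}}f$). Moreover, the point $\mathbf q^\star=(y_{q_i})_{i=1}^n$ is an optimal solution of the problem, and $\delta_{\mathbf q^\star}$ represents the truncated sequence $\mathbf y$.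
   Context: $\mathbb H$ is the skew field of quaternions, $\mathcal R(a)$ the real part. Fix $n\ge1$ and letters $q_1,\dots,q_n,\bar q_1,\dots,\bar q_n$. $\mathcal W$ is the set of words (including the empty word $1$) in these letters, where words with the same normal form are identified: any consecutive factor $q_i\bar q_i$ or $\bar q_iq_i$ is written $|q_i|^2$ and moved to the front, so each word is uniquely $\prod_i|q_i|^{2\alpha_i}\tilde w$ with $\tilde w$ containing no such factor. $|w|$ is the length, $\mathcal W_t$ the words of length at most $t$; $w^*$ is obtained by reversing $w$ and exchanging $q_i\leftrightarrow\bar q_i$. $\mathbb R\langle\mathbf q,\bar{\mathbf q}\rangle$ is the real $*$-algebra of finite sums $\sum_wp_ww$, $p_w\in\mathbb R$. $\mathscr P\langle\mathbf q,\bar{\mathbf q}\rangle$ is the space of finite sums $p=\sum_{a,b\in\mathcal W}a\,p_{a,b}\,b$, $p_{a,b}\in\mathbb H$ (inside the real free product of $\mathbb H$ and $\mathbb R\langle\mathbf q,\bar{\mathbf q}\rangle$, constants not commuting with letters), with $p^*=\sum b^*\bar p_{a,b}a^*$ and $\deg p=\max\{|a|+|b|:p_{a,b}\ne0\}$. $\operatorname{Sym}$ denotes elements with $p=p^*$ (real-valued under evaluation); $[a,b]$ is the commutator. Words $u,v$ are cyclically equivalent, $u\stackrel{\mathrm{cyc}}{\sim}v$, if $u=w_1w_2$, $v=w_2w_1$ for some words. $K_{\mathbf g,\mathbf h}=\{\mathbf a\in\mathbb H^n:g_i(\mathbf a,\bar{\mathbf a})\ge0\ (1\le i\le m),\ h_j(\mathbf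 a,\bar{\mathbf a})=0\ (1\le j\le\ell)\}$ (evaluation $q_i\mapsto a_i$, $\bar q_i\mapsto\bar a_i$). For $\mathbf y=(y_w)_{w\in\mathcal W_{2d}}$ in $\mathbb H$: $L_{\mathbf y}(\sum p_ww)=\sum p_wy_w\in\mathbb H$ for real $p_w$; $L_{\mathbf y}^{\mathcal R}(\sum a\,p_{a,b}\,b)=\mathcal R(\sum p_{a,b}y_{ba})$; $[\mathbf M_t(\mathbf y)]_{u,v}=L_{\mathbf y}(u^*v)$; for $g\in\operatorname{Sym}\mathbb R\langle\mathbf q,\bar{\mathbf q}\rangle$, $[\mathbf M_t(g\mathbf y)]_{u,v}=L_{\mathbf y}(u^*gv)$; for $g\in\operatorname{Sym}\mathscr P\langle\mathbf q,\bar{\mathbf q}\rangle$, $[\mathbf M_t^{\mathcal R}(g\mathbf y)]_{u,v}=L_{\mathbf y}^{\mathcal R}(u^*gv)$ (a real matrix); $u,v\in\mathcal W_t$. $\succeq0$ means Hermitian with nonnegative quadratic form; $\operatorname{rank}_{\mathbb H}$ is the quaternionic (right column) rank. Here $d\ge1$ and $2d$ is at least the degrees of $f$, $g_i$, $h_j$. Both relaxations minimize $L_{\mathbf y}^{\mathcal R}(f)$ over $\mathbf y=(y_w)_{w\in\mathcal W_{2d}}$ in $\mathbb H$ subject to: $y_1=1$; $y_w=\overline{y_{w^*}}$ for $w\in\mathcal W_{2d}$; $\mathcal R(y_u)=\mathcal R(y_v)$ whenever $u\stackrel{\mathrm{cyc}}{\sim}v$, $u,v\in\mathcal W_{2d}$;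 $\mathbf M_d(\mathbf y)\succeq0$; $L_{\mathbf y}(u[w+w^*,q_i]v)=0$ for all $i$ and words with $|u|+|v|+|w|\le2d-1$; and in addition — (Mom-$\mathbb H$): $\mathbf M_{d-\lceil\deg(g_i)/2\rceil}(g_i\mathbf y)\succeq0$ for all $i$, and $L_{\mathbf y}(uh_jv)=0$ for all $j$ and words $u,v$ with $|u|+|v|\le2d-\deg h_j$; — (Mom-$\mathbb H,\mathbb R$): $\mathbf M^{\mathcal R}_{d-\lceil\deg(g_i)/2\rceil}(g_i\mathbf y)\succeq0$ for all $i$, and $L_{\mathbf y}^{\mathcal R}(uh_jv)=0$ for all $j$ and words $u,v$ with $|u|+|v|\le2d-\deg h_j$. $\delta_{\mathbf q^\star}$ represents $\mathbf y$ means $y_w=w(\mathbf q^\star,\overline{\mathbf q^\star})$ for all $w\in\mathcal W_{2d}$. *)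

theory Defs
  imports "HOL-Analysis.Analysis" "HOL-Library.Poly_Mapping"
begin

section \<open>The skew field of quaternions\<close>

codatatype quat = Quat (qre: real) (qi: real) (qj: real) (qk: real)

lemma quat_eq_iff: "x = y \<longleftrightarrow> qre x = qre y \<and> qi x = qi y \<and> qj x = qj y \<and> qk x = qk y"
  by (auto intro: quat.expand)

instantiation quat :: ab_group_add
begin

primcorec zero_quat where
  "qre 0 = 0" | "qi 0 = 0" | "qj 0 = 0" | "qk 0 = 0"

primcorec plus_quat where
  "qre (x + y) = qre x + qre y" | "qi (x + y) = qi x + qi y"
| "qj (x + y) = qj x + qj y" | "qk (x + y) = qk x + qk y"

primcorec uminus_quat where
  "qre (- x) = - qre x" | "qi (- x) = - qi x" | "qj (- x) = - qj x" | "qk (- x) = - qk x"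

primcorec minus_quat where
  "qre (x - y) = qre x - qre y" | "qi (x - y) = qi x - qi y"
| "qj (x - y) = qj x - qj y" | "qk (x - y) = qk x - qk y"

instance
  by standard (simp_all add: quat_eq_iff)

end

primcorec qcnj :: "quat \<Rightarrow> quat" where
  "qre (qcnj x) = qre x" | "qi (qcnj x) = - qi x"
| "qj (qcnj x) = - qj x" | "qk (qcnj x) = - qk x"

definition qnorm2 :: "quat \<Rightarrow> real" where
  "qnorm2 x = (qre x)\<^sup>2 + (qi x)\<^sup>2 + (qj x)\<^sup>2 + (qk x)\<^sup>2"

lemma qnorm2_eq_0_iff: "qnorm2 x = 0 \<longleftrightarrow> x = 0"
  unfolding qnorm2_def quat_eq_iff by (simp add: add_nonneg_eq_0_iff)

instantiation quat :: real_algebra_1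
begin

primcorec one_quat where
  "qre 1 = 1" | "qi 1 = 0" | "qj 1 = 0" | "qk 1 = 0"

primcorec times_quat where
  "qre (x * y) = qre x * qre y - qi x * qi y - qj x * qj y - qk x * qk y"
| "qi (x * y) = qre x * qi y + qi x * qre y + qj x * qk y - qk x * qj y"
| "qj (x * y) = qre x * qj y - qi x * qk y + qj x * qre y + qk x * qi y"
| "qk (x * y) = qre x * qk y + qi x * qj y - qj x * qi y + qk x * qre y"

primcorec scaleR_quat where
  "qre (scaleR r x) = r * qre x" | "qi (scaleR r x) = r * qi x"
| "qj (scaleR r x) = r * qj x" | "qk (scaleR r x) = r * qk x"

instance
  by standard (simp_all add: quat_eq_iff algebra_simps)

end

lemma mult_qcnj_scaleR:
  "x * qcnj x = scaleR (qnorm2 x) 1" "qcnj x * x = scaleR (qnorm2 x) 1"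
  by (simp_all add: quat_eq_iff qnorm2_def power2_eq_square algebra_simps)

instantiation quat :: real_div_algebra
begin

definition inverse_quat :: "quat \<Rightarrow> quat" where
  "inverse x = scaleR (1 / qnorm2 x) (qcnj x)"

definition divide_quat :: "quat \<Rightarrow> quat \<Rightarrow> quat" where
  "x div y = x * inverse y" for x y :: quat

instance
  by standard
    (auto simp: inverse_quat_def divide_quat_def mult_qcnj_scaleR qnorm2_eq_0_iff quat_eq_iff[of _ 0])

end

lemma qparts_of_real [simp]:
  "qre (of_real r) = r" "qi (of_real r) = 0" "qj (of_real r) = 0" "qk (of_real r) = 0"
  by (simp_all add: of_real_def)

lemma qparts_sum:
  "qre (sum F A) = (\<Sum>x\<in>A. qre (F x))" "qi (sum F A) = (\<Sum>x\<in>A. qi (F x))"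
  "qj (sum F A) = (\<Sum>x\<in>A. qj (F x))" "qk (sum F A) = (\<Sum>x\<in>A. qk (F x))"
  by (induction A rule: infinite_finite_induct) auto

lemma qcnj_simps [simp]:
  "qcnj 0 = 0" "qcnj 1 = 1" "qcnj (qcnj x) = x" "qcnj (x + y) = qcnj x + qcnj y"
  "qcnj (x * y) = qcnj y * qcnj x" "qcnj (of_real r) = of_real r"
  by (simp_all add: quat_eq_iff)

lemma mult_qcnj: "x * qcnj x = of_real (qnorm2 x)" "qcnj x * x = of_real (qnorm2 x)"
  by (simp_all add: quat_eq_iff qnorm2_def power2_eq_square algebra_simps)

lemma of_real_mult_commute_quat: "of_real r * x = x * (of_real r :: quat)"
  by (simp add: of_real_def)


section \<open>Words\<close>

datatype 'n letter = Q 'n | Qbar 'n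

primrec lstar :: "'n letter \<Rightarrow> 'n letter" where
  "lstar (Q i) = Qbar i" | "lstar (Qbar i) = Q i"

primrec lvar :: "'n letter \<Rightarrow> 'n" where
  "lvar (Q i) = i" | "lvar (Qbar i) = i"

lemma lstar_lstar [simp]: "lstar (lstar x) = x" and lvar_lstar [simp]: "lvar (lstar x) = lvar x"
  by (cases x; simp)+

text \<open>
  One normalisation step: a consecutive factor \<open>q\<^sub>i q\<^sub>i\<^sup>*\<close> or \<open>q\<^sub>i\<^sup>* q\<^sub>i\<close> becomes \<open>|q\<^sub>i|\<^sup>2\<close>, spelled
  \<open>q\<^sub>i q\<^sub>i\<^sup>*\<close>, and moves to the front. Two strings are the same word iff these steps connect them;
  \<open>word_eq_iff_normal_form\<close> below shows that this is equality of normal forms.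
\<close>

inductive norm_step :: "'n letter list \<Rightarrow> 'n letter list \<Rightarrow> bool" where
  "norm_step (a @ [x, lstar x] @ b) ([Q (lvar x), Qbar (lvar x)] @ a @ b)"

abbreviation word_eq :: "'n letter list \<Rightarrow> 'n letter list \<Rightarrow> bool" where
  "word_eq \<equiv> equivclp norm_step"

lemma word_eq_induct [consumes 1, case_names step refl sym trans]:
  assumes "word_eq u v"
    and step: "\<And>a x b. P (a @ [x, lstar x] @ b) ([Q (lvar x), Qbar (lvar x)] @ a @ b)"
    and refl: "\<And>u. P u u" and sym: "\<And>u v. P u v \<Longrightarrow> P v u"
    and trans: "\<And>u v w. P u v \<Longrightarrow> P v w \<Longrightarrow> P u w"
  shows "P u v"
  using assms(1)
proof (induction rule: equivclp_induct)
  case base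
  show ?case by (rule refl)
next
  case (step v w)
  have "P v w" using step(2)
    by (auto elim!: norm_step.cases intro: sym assms(2) simp del: append.simps)
  with step.IH show ?case by (rule trans)
qed

lemma word_eq_trans: "word_eq u v \<Longrightarrow> word_eq v w \<Longrightarrow> word_eq u w"
  by (rule equivclp_trans)

lemma word_eq_sym: "word_eq u v \<Longrightarrow> word_eq v u"
  by (rule equivclp_sym)

lemma word_eq_front: "word_eq (a @ [x, lstar x] @ b) ([Q (lvar x), Qbar (lvar x)] @ a @ b)"
  by (rule r_into_equivclp, rule norm_step.intros)

lemma word_eq_append_right: "word_eq u v \<Longrightarrow> word_eq (u @ c) (v @ c)"
proof (induction rule: word_eq_induct)
  case (step a x b)
  show ?case using word_eq_front[of a x "b @ c"] by simp
qed (auto intro: word_eq_sym word_eq_trans)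

lemma word_eq_append_left: "word_eq u v \<Longrightarrow> word_eq (c @ u) (c @ v)"
proof (induction rule: word_eq_induct)
  case (step a x b)
  have "word_eq (c @ a @ [x, lstar x] @ b) ([Q (lvar x), Qbar (lvar x)] @ c @ a @ b)"
    using word_eq_front[of "c @ a" x b] by simp
  moreover have "word_eq (c @ [Q (lvar x), Qbar (lvar x)] @ a @ b)
      ([Q (lvar x), Qbar (lvar x)] @ c @ a @ b)"
    using word_eq_front[of c "Q (lvar x)" "a @ b"] by simp
  ultimately show ?case by (blast intro: word_eq_sym word_eq_trans)
qed (auto intro: word_eq_sym word_eq_trans)

lemma word_eq_append: "word_eq u u' \<Longrightarrow> word_eq v v' \<Longrightarrow> word_eq (u @ v) (u' @ v')"
  by (blast intro: word_eq_append_left word_eq_append_right word_eq_trans)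

lemma word_eq_length: "word_eq u v \<Longrightarrow> length u = length v"
  by (induction rule: word_eq_induct) auto

lemma word_eq_rev: "word_eq u v \<Longrightarrow> word_eq (rev (map lstar u)) (rev (map lstar v))"
proof (induction rule: word_eq_induct)
  case (step a x b)
  let ?a = "rev (map lstar a)" and ?b = "rev (map lstar b)"
  have "word_eq (?b @ [x, lstar x] @ ?a) ([Q (lvar x), Qbar (lvar x)] @ ?b @ ?a)"
    by (rule word_eq_front)
  moreover have "word_eq ((?b @ ?a) @ [Q (lvar x), Qbar (lvar x)] @ [])
      ([Q (lvar x), Qbar (lvar x)] @ (?b @ ?a) @ [])"
    using word_eq_front[of "?b @ ?a" "Q (lvar x)" "[]"] by simp
  ultimately show ?case by (simp, blast intro: word_eq_sym word_eq_trans)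
qed (auto intro: word_eq_sym word_eq_trans)

quotient_type 'n qword = "'n letter list" / "word_eq"
  by (rule equivp_evquivclp)

instantiation qword :: (type) monoid_mult
begin

lift_definition one_qword :: "'a qword" is "[]" .

lift_definition times_qword :: "'a qword \<Rightarrow> 'a qword \<Rightarrow> 'a qword" is "(@)"
  by (rule word_eq_append)

instance
  by standard (transfer, simp)+

end

text \<open>
  The convolution product of \<^theory>\<open>HOL-Library.Poly_Mapping\<close> wants the monoid written additively.
  Concatenation is therefore also available as \<open>+\<close>, which makes \<open>'n qword \<Rightarrow>\<^sub>0 real\<close> the monoid
  algebra of the words.
\<close>

instantiation qword :: (type) monoid_add
begin

definition zero_qword :: "'a qword" where "0 = (1 :: 'a qword)"
definition plus_qword :: "'a qword \<Rightarrow> 'a qword \<Rightarrow> 'a qword" where "u + v = u * v" for u v :: "'a qword"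

instance
  by standard (simp_all add: zero_qword_def plus_qword_def mult.assoc)

end

lift_definition wlet :: "'n letter \<Rightarrow> 'n qword" is "\<lambda>x. [x]" .

lift_definition wlen :: "'n qword \<Rightarrow> nat" is length
  by (rule word_eq_length)

lift_definition wstar :: "'n qword \<Rightarrow> 'n qword" is "\<lambda>u. rev (map lstar u)"
  by (rule word_eq_rev)

definition words :: "nat \<Rightarrow> 'n qword set" where
  "words t = {w. wlen w \<le> t}"

definition cyc_equiv :: "'n qword \<Rightarrow> 'n qword \<Rightarrow> bool" where
  "cyc_equiv u v \<longleftrightarrow> (\<exists>w1 w2. u = w1 * w2 \<and> v = w2 * w1)"

lemma wlen_simps [simp]:
  "wlen 1 = 0" "wlen (u * v) = wlen u + wlen v" "wlen (wlet x) = 1" "wlen (wstar u) = wlen u"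
  by (transfer; simp)+

lemma wstar_simps [simp]:
  "wstar 1 = 1" "wstar (u * v) = wstar v * wstar u" "wstar (wlet x) = wlet (lstar x)"
  "wstar (wstar u) = u"
  by (transfer; simp add: rev_map o_def)+

lemma finite_words: "finite (words t :: 'n::finite qword set)"
proof -
  have "finite (UNIV :: 'n letter set)"
  proof (rule finite_subset)
    show "UNIV \<subseteq> range Q \<union> range (Qbar :: 'n \<Rightarrow> _)"
      by (metis UNIV_I UnCI letter.exhaust rangeI subsetI)
  qed auto
  then have "finite {xs :: 'n letter list. set xs \<subseteq> UNIV \<and> length xs \<le> t}"
    by (rule finite_lists_length_le)
  moreover have "words t \<subseteq> abs_qword ` {xs :: 'n letter list. set xs \<subseteq> UNIV \<and> length xs \<le> t}"
  proof
    fix w :: "'n qword" assume "w \<in> words t"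
    moreover obtain xs where "w = abs_qword xs" by (metis Quotient3_qword Quotient3_abs_rep)
    ultimately show "w \<in> abs_qword ` {xs. set xs \<subseteq> UNIV \<and> length xs \<le> t}"
      by (auto simp: words_def wlen.abs_eq)
  qed
  ultimately show ?thesis by (blast intro: finite_subset)
qed


subsection \<open>Normal forms\<close>

text \<open>
  The normal form of a string: the exponents of the \<open>|q\<^sub>i|\<^sup>2\<close>, and a string in which no letter is
  adjacent to its conjugate.
\<close>

definition bump :: "'n \<Rightarrow> ('n \<Rightarrow> nat) \<times> 'n letter list \<Rightarrow> ('n \<Rightarrow> nat) \<times> 'n letter list" where
  "bump i s = ((fst s)(i := Suc (fst s i)), snd s)"

definition push :: "'n letter \<Rightarrow> ('n \<Rightarrow> nat) \<times> 'n letter list \<Rightarrow> ('n \<Rightarrow> nat) \<times> 'n letter list" where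
  "push x s = (if snd s \<noteq> [] \<and> hd (snd s) = lstar x then bump (lvar x) (fst s, tl (snd s))
     else (fst s, x # snd s))"

definition normal_form :: "'n letter list \<Rightarrow> ('n \<Rightarrow> nat) \<times> 'n letter list" where
  "normal_form w = foldr push w (\<lambda>_. 0, [])"

fun reduced :: "'n letter list \<Rightarrow> bool" where
  "reduced (x # y # zs) \<longleftrightarrow> y \<noteq> lstar x \<and> reduced (y # zs)"
| "reduced _ \<longleftrightarrow> True"

lemma reduced_push: "reduced (snd s) \<Longrightarrow> reduced (snd (push x s))"
  by (cases "snd s" rule: reduced.cases) (auto simp: push_def bump_def)

lemma normal_form_Cons: "normal_form (x # w) = push x (normal_form w)"
  by (simp add: normal_form_def)

lemma reduced_normal_form: "reduced (snd (normal_form w))"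
  unfolding normal_form_def by (induction w) (auto intro: reduced_push)

lemma push_bump: "push x (bump i s) = bump i (push x s)"
  by (auto simp: push_def bump_def)

lemma foldr_push_bump: "foldr push a (bump i s) = bump i (foldr push a s)"
  by (induction a) (auto simp: push_bump)

lemma push_push: "reduced (snd s) \<Longrightarrow> push x (push (lstar x) s) = bump (lvar x) s"
  by (cases "snd s" rule: reduced.cases) (auto simp: push_def bump_def prod_eq_iff)

lemma normal_form_invariant: "word_eq u v \<Longrightarrow> normal_form u = normal_form v"
proof (induction rule: word_eq_induct)
  case (step a x b)
  have *: "push x (push (lstar x) (normal_form c)) = bump (lvar x) (normal_form c)"
    for x :: "'a letter" and c
    by (intro push_push reduced_normal_form)
  have app: "normal_form (c @ e) = foldr push c (normal_form e)" for c e :: "'a letter list"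
    by (simp add: normal_form_def)
  show ?case
    using *[of x b] *[of "Q (lvar x)" "a @ b"] by (simp add: app foldr_push_bump normal_form_Cons)
qed auto

definition squares :: "'n list \<Rightarrow> 'n letter list" where
  "squares is = concat (map (\<lambda>i. [Q i, Qbar i]) is)"

lemma squares_simps [simp]:
  "squares [] = []" "squares (i # is) = [Q i, Qbar i] @ squares is"
  "squares (is @ js) = squares is @ squares js"
  by (simp_all add: squares_def)

lemma word_eq_squares:
  "(\<And>i. count_list is i = count_list js i) \<Longrightarrow> word_eq (squares is @ r) (squares js @ r)"
proof (induction "is" arbitrary: js)
  case Nil
  have "js = []"
  proof (cases js)
    case (Cons j js')
    then show ?thesis using Nil[of j] by simp
  qed
  then show ?case by simp
next
  case (Cons i "is")
  have "count_list js i \<noteq> 0" using Cons.prems[of i] by simp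
  then have "i \<in> set js" by (metis count_list_0_iff)
  then obtain j1 j2 where js: "js = j1 @ i # j2" by (meson split_list)
  have "count_list is k = count_list (j1 @ j2) k" for k
    using Cons.prems[of k] by (auto simp: js split: if_splits)
  then have "word_eq ([Q i, Qbar i] @ squares is @ r) ([Q i, Qbar i] @ squares (j1 @ j2) @ r)"
    by (intro word_eq_append_left Cons.IH)
  moreover have "word_eq (squares js @ r) ([Q i, Qbar i] @ squares (j1 @ j2) @ r)"
    using word_eq_front[of "squares j1" "Q i" "squares j2 @ r"] by (simp add: js)
  ultimately have "word_eq ([Q i, Qbar i] @ squares is @ r) (squares js @ r)"
    by (rule word_eq_trans[OF _ word_eq_sym])
  then show ?case by simp
qed

lemma word_eq_normal_form:
  "\<exists>is. word_eq w (squares is @ snd (normal_form w)) \<and> count_list is = fst (normal_form w)"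
proof (induction w)
  case Nil
  show ?case by (intro exI[of _ "[]"]) (auto simp: normal_form_def)
next
  case (Cons x w)
  obtain "is" where "is": "word_eq w (squares is @ snd (normal_form w))"
    "count_list is = fst (normal_form w)"
    using Cons.IH by blast
  have nf: "normal_form (x # w) = push x (normal_form w)" by (simp add: normal_form_def)
  have mv: "word_eq (x # squares is @ r) (squares is @ x # r)" for r
  proof (induction "is")
    case (Cons i "is")
    have "word_eq (x # squares (i # is) @ r) ([Q i, Qbar i] @ x # squares is @ r)"
      using word_eq_front[of "[x]" "Q i" "squares is @ r"] by simp
    moreover have "word_eq ([Q i, Qbar i] @ x # squares is @ r) ([Q i, Qbar i] @ squares is @ x # r)"
      by (rule word_eq_append_left) (rule Cons)
    ultimately have "word_eq (x # squares (i # is) @ r) ([Q i, Qbar i] @ squares is @ x # r)"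
      by (rule word_eq_trans)
    then show ?case by simp
  qed simp
  have 1: "word_eq (x # w) (squares is @ x # snd (normal_form w))"
    using word_eq_trans[OF word_eq_append_left[OF "is"(1), of "[x]"], simplified, OF mv] .
  show ?case
  proof (cases "snd (normal_form w) \<noteq> [] \<and> hd (snd (normal_form w)) = lstar x")
    case True
    then obtain r where r: "snd (normal_form w) = lstar x # r" by (cases "snd (normal_form w)") auto
    have "word_eq (x # w) (squares (lvar x # is) @ r)"
      using word_eq_trans[OF 1[unfolded r] word_eq_front[of "squares is" x r, simplified]] by simp
    then show ?thesis
      by (intro exI[of _ "lvar x # is"]) (auto simp: nf push_def bump_def r "is"(2)[symmetric] fun_eq_iff)
  next
    case False
    then have "normal_form (x # w) = (fst (normal_form w), x # snd (normal_form w))"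
      by (auto simp: nf push_def)
    with 1 "is"(2) show ?thesis by (intro exI[of _ "is"]) simp
  qed
qed

theorem word_eq_iff_normal_form: "word_eq u v \<longleftrightarrow> normal_form u = normal_form v"
proof
  assume eq: "normal_form u = normal_form v"
  obtain "is" js where
    "word_eq u (squares is @ snd (normal_form u))" "count_list is = fst (normal_form u)"
    "word_eq v (squares js @ snd (normal_form v))" "count_list js = fst (normal_form v)"
    using word_eq_normal_form[of u] word_eq_normal_form[of v] by blast
  moreover have "word_eq (squares is @ snd (normal_form u)) (squares js @ snd (normal_form v))"
    using calculation eq by (metis word_eq_squares)
  ultimately show "word_eq u v" by (meson word_eq_sym word_eq_trans)
qed (rule normal_form_invariant)


subsection \<open>Evaluation of words\<close>

primrec leval :: "quat ^ 'n \<Rightarrow> 'n letter \<Rightarrow> quat" where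
  "leval a (Q i) = a $ i" | "leval a (Qbar i) = qcnj (a $ i)"

lift_definition weval :: "quat ^ 'n \<Rightarrow> 'n qword \<Rightarrow> quat"
  is "\<lambda>a w. prod_list (map (leval a) w)"
proof -
  fix a :: "quat ^ 'n" and u v :: "'n letter list"
  assume "word_eq u v"
  then show "prod_list (map (leval a) u) = prod_list (map (leval a) v)"
  proof (induction rule: word_eq_induct)
    case (step b x c)
    have *: "leval a x * (leval a (lstar x) * z) = of_real (qnorm2 (a $ lvar x)) * z" for x z
      by (cases x) (simp_all add: mult.assoc[symmetric] mult_qcnj)
    show ?case
      using *[of "Q (lvar x)"]
      by (simp add: *) (metis mult.assoc of_real_mult_commute_quat)
  qed auto
qed

lemma weval_simps [simp]:
  "weval a 1 = 1" "weval a (u * v) = weval a u * weval a v" "weval a (wlet x) = leval a x"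
  by (transfer; simp)+

lemma weval_wstar [simp]: "weval a (wstar u) = qcnj (weval a u)"
proof transfer
  fix a :: "quat ^ 'n" and u :: "'n letter list"
  have "leval a (lstar x) = qcnj (leval a x)" for x by (cases x) auto
  then show "prod_list (map (leval a) (rev (map lstar u))) = qcnj (prod_list (map (leval a) u))"
    by (induction u) auto
qed


section \<open>Polynomials with real coefficients\<close>

type_synonym 'n rpoly = "'n qword \<Rightarrow>\<^sub>0 real"

abbreviation mon :: "'n qword \<Rightarrow> 'n rpoly" where
  "mon w \<equiv> Poly_Mapping.single w 1"

definition rstar :: "'n rpoly \<Rightarrow> 'n rpoly" where
  "rstar p = (\<Sum>w\<in>Poly_Mapping.keys p. Poly_Mapping.single (wstar w) (Poly_Mapping.lookup p w))"

definition rsym :: "'n rpoly \<Rightarrow> bool" where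
  "rsym p \<longleftrightarrow> p = rstar p"

definition rdeg :: "'n rpoly \<Rightarrow> nat" where
  "rdeg p = Max (insert 0 (wlen ` Poly_Mapping.keys p))"

definition reval :: "'n rpoly \<Rightarrow> quat ^ 'n \<Rightarrow> quat" where
  "reval p a = (\<Sum>w\<in>Poly_Mapping.keys p. of_real (Poly_Mapping.lookup p w) * weval a w)"

definition commutator :: "'n rpoly \<Rightarrow> 'n rpoly \<Rightarrow> 'n rpoly" where
  "commutator p q = p * q - q * p"


section \<open>Polynomials with quaternionic constants\<close>

text \<open>
  A finite sum \<open>\<Sum> a p\<^bsub>a,b\<^esub> b\<close> is given by its coefficient family. Inside the real free product of
  the quaternions and the words algebra, several families denote the same element, because
  real constants are central: \<open>a r b = 1 r (a b)\<close> for real \<open>r\<close>. This is the only relation: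
  writing \<open>B\<close> for the algebra of words and \<open>I\<close> for the imaginary quaternions, the sums form the
  subspace \<open>B \<oplus> (B \<otimes> I \<otimes> B)\<close> of the free product, which \<open>hequiv\<close> expresses. Degree and
  Riesz functional below are computed from the given family, so that statements about
  \<open>'n hpoly\<close> hold for every way of writing an element as such a sum.
\<close>

type_synonym 'n hpoly = "'n qword \<times> 'n qword \<Rightarrow>\<^sub>0 quat"

definition qim :: "quat \<Rightarrow> quat" where
  "qim x = x - of_real (qre x)"

definition real_part :: "'n hpoly \<Rightarrow> 'n qword \<Rightarrow> real" where
  "real_part p w =
     (\<Sum>(a, b) | (a, b) \<in> Poly_Mapping.keys p \<and> a * b = w. qre (Poly_Mapping.lookup p (a, b)))"

definition hequiv :: "'n hpoly \<Rightarrow> 'n hpoly \<Rightarrow> bool" where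
  "hequiv p p' \<longleftrightarrow>
     (\<forall>a b. qim (Poly_Mapping.lookup p (a, b)) = qim (Poly_Mapping.lookup p' (a, b))) \<and>
     (\<forall>w. real_part p w = real_part p' w)"

definition hstar :: "'n hpoly \<Rightarrow> 'n hpoly" where
  "hstar p = (\<Sum>(a, b)\<in>Poly_Mapping.keys p.
     Poly_Mapping.single (wstar b, wstar a) (qcnj (Poly_Mapping.lookup p (a, b))))"

definition hsym :: "'n hpoly \<Rightarrow> bool" where
  "hsym p \<longleftrightarrow> hequiv p (hstar p)"

definition hdeg :: "'n hpoly \<Rightarrow> nat" where
  "hdeg p = Max (insert 0 ((\<lambda>(a, b). wlen a + wlen b) ` Poly_Mapping.keys p))"

definition heval :: "'n hpoly \<Rightarrow> quat ^ 'n \<Rightarrow> quat" where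
  "heval p x = (\<Sum>(a, b)\<in>Poly_Mapping.keys p. weval x a * Poly_Mapping.lookup p (a, b) * weval x b)"

text \<open>The product \<open>u p v\<close> with words \<open>u\<close>, \<open>v\<close>.\<close>

definition hsandwich :: "'n qword \<Rightarrow> 'n hpoly \<Rightarrow> 'n qword \<Rightarrow> 'n hpoly" where
  "hsandwich u p v = (\<Sum>(a, b)\<in>Poly_Mapping.keys p.
     Poly_Mapping.single (u * a, b * v) (Poly_Mapping.lookup p (a, b)))"


section \<open>Moment sequences\<close>

text \<open>
  A truncated sequence is a function on all words. Everything below, at order \<open>d\<close> and with
  polynomials of degree at most \<open>2 * d\<close>, only looks at its values on \<open>words (2 * d)\<close>.
\<close>

definition riesz :: "('n qword \<Rightarrow> quat) \<Rightarrow> 'n rpoly \<Rightarrow> quat" where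
  "riesz y p = (\<Sum>w\<in>Poly_Mapping.keys p. of_real (Poly_Mapping.lookup p w) * y w)"

definition riesz_re :: "('n qword \<Rightarrow> quat) \<Rightarrow> 'n hpoly \<Rightarrow> real" where
  "riesz_re y p = qre (\<Sum>(a, b)\<in>Poly_Mapping.keys p. Poly_Mapping.lookup p (a, b) * y (b * a))"

text \<open>Matrices are functions of two words; the truncation order enters through an index set.\<close>

definition moment_matrix :: "('n qword \<Rightarrow> quat) \<Rightarrow> 'n qword \<Rightarrow> 'n qword \<Rightarrow> quat" where
  "moment_matrix y u v = riesz y (mon (wstar u) * mon v)"

definition loc_matrix :: "'n rpoly \<Rightarrow> ('n qword \<Rightarrow> quat) \<Rightarrow> 'n qword \<Rightarrow> 'n qword \<Rightarrow> quat" where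
  "loc_matrix g y u v = riesz y (mon (wstar u) * g * mon v)"

definition loc_matrix_re :: "'n hpoly \<Rightarrow> ('n qword \<Rightarrow> quat) \<Rightarrow> 'n qword \<Rightarrow> 'n qword \<Rightarrow> real" where
  "loc_matrix_re g y u v = riesz_re y (hsandwich (wstar u) g v)"

text \<open>For a Hermitian quaternionic matrix the quadratic form is real, hence the real part.\<close>

definition quat_psd :: "'w set \<Rightarrow> ('w \<Rightarrow> 'w \<Rightarrow> quat) \<Rightarrow> bool" where
  "quat_psd S M \<longleftrightarrow>
     (\<forall>u\<in>S. \<forall>v\<in>S. M u v = qcnj (M v u)) \<and>
     (\<forall>x. 0 \<le> qre (\<Sum>u\<in>S. \<Sum>v\<in>S. qcnj (x u) * M u v * x v))"

definition real_psd :: "'w set \<Rightarrow> ('w \<Rightarrow> 'w \<Rightarrow> real) \<Rightarrow> bool" where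
  "real_psd S M \<longleftrightarrow>
     (\<forall>u\<in>S. \<forall>v\<in>S. M u v = M v u) \<and>
     (\<forall>x. 0 \<le> (\<Sum>u\<in>S. \<Sum>v\<in>S. x u * M u v * x v))"

text \<open>The right column rank: the largest number of right linearly independent columns.\<close>

definition right_indep_columns :: "'w set \<Rightarrow> ('w \<Rightarrow> 'w \<Rightarrow> quat) \<Rightarrow> 'w set \<Rightarrow> bool" where
  "right_indep_columns S M C \<longleftrightarrow>
     (\<forall>c. (\<forall>u\<in>S. (\<Sum>v\<in>C. M u v * c v) = 0) \<longrightarrow> (\<forall>v\<in>C. c v = 0))"

definition quat_rank :: "'w set \<Rightarrow> ('w \<Rightarrow> 'w \<Rightarrow> quat) \<Rightarrow> nat" where
  "quat_rank S M = Max {card C | C. C \<subseteq> S \<and> right_indep_columns S M C}"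


section \<open>The optimization problem and its relaxations\<close>

text \<open>
  The constraints enter through their evaluations. Values of symmetric polynomials are real,
  so \<open>g(a) \<ge> 0\<close> is stated for the real part, and so is the objective in the theorem.
\<close>

definition feasible_points ::
  "nat \<Rightarrow> nat \<Rightarrow> (nat \<Rightarrow> quat ^ 'n \<Rightarrow> quat) \<Rightarrow> (nat \<Rightarrow> quat ^ 'n \<Rightarrow> quat) \<Rightarrow> (quat ^ 'n) set" where
  "feasible_points m l g h =
     {a. (\<forall>i\<in>{1..m}. 0 \<le> qre (g i a)) \<and> (\<forall>j\<in>{1..l}. h j a = 0)}"

definition mom_common :: "nat \<Rightarrow> ('n qword \<Rightarrow> quat) \<Rightarrow> bool" where
  "mom_common d y \<longleftrightarrow>
     y 1 = 1 \<and>
     (\<forall>w\<in>words (2 * d). y w = qcnj (y (wstar w))) \<and>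
     (\<forall>u\<in>words (2 * d). \<forall>v\<in>words (2 * d). cyc_equiv u v \<longrightarrow> qre (y u) = qre (y v)) \<and>
     quat_psd (words d) (moment_matrix y) \<and>
     (\<forall>i u v w. wlen u + wlen v + wlen w \<le> 2 * d - 1 \<longrightarrow>
        riesz y (mon u * commutator (mon w + mon (wstar w)) (mon (wlet (Q i))) * mon v) = 0)"

definition mom_H ::
  "nat \<Rightarrow> nat \<Rightarrow> nat \<Rightarrow> (nat \<Rightarrow> 'n rpoly) \<Rightarrow> (nat \<Rightarrow> 'n rpoly) \<Rightarrow> ('n qword \<Rightarrow> quat) set" where
  "mom_H d m l g h =
     {y. mom_common d y \<and>
        (\<forall>i\<in>{1..m}. quat_psd (words (d - nat \<lceil>real (rdeg (g i)) / 2\<rceil>)) (loc_matrix (g i) y)) \<and>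
        (\<forall>j\<in>{1..l}. \<forall>u v. wlen u + wlen v \<le> 2 * d - rdeg (h j) \<longrightarrow>
           riesz y (mon u * h j * mon v) = 0)}"

definition mom_HR ::
  "nat \<Rightarrow> nat \<Rightarrow> nat \<Rightarrow> (nat \<Rightarrow> 'n hpoly) \<Rightarrow> (nat \<Rightarrow> 'n hpoly) \<Rightarrow> ('n qword \<Rightarrow> quat) set" where
  "mom_HR d m l g h =
     {y. mom_common d y \<and>
        (\<forall>i\<in>{1..m}. real_psd (words (d - nat \<lceil>real (hdeg (g i)) / 2\<rceil>)) (loc_matrix_re (g i) y)) \<and>
        (\<forall>j\<in>{1..l}. \<forall>u v. wlen u + wlen v \<le> 2 * d - hdeg (h j) \<longrightarrow>
           riesz_re y (hsandwich u (h j) v) = 0)}"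

definition optimal_solution :: "'s set \<Rightarrow> ('s \<Rightarrow> real) \<Rightarrow> 's \<Rightarrow> bool" where
  "optimal_solution S F x \<longleftrightarrow> x \<in> S \<and> (\<forall>x'\<in>S. F x \<le> F x')"

definition optimal_value :: "'s set \<Rightarrow> ('s \<Rightarrow> real) \<Rightarrow> ereal" where
  "optimal_value S F = (INF x\<in>S. ereal (F x))"

definition dirac_represents :: "nat \<Rightarrow> quat ^ 'n \<Rightarrow> ('n qword \<Rightarrow> quat) \<Rightarrow> bool" where
  "dirac_represents d a y \<longleftrightarrow> (\<forall>w\<in>words (2 * d). y w = weval a w)"

definition first_moments :: "('n qword \<Rightarrow> quat) \<Rightarrow> quat ^ 'n" where
  "first_moments y = (\<chi> i. y (wlet (Q i)))"

section \<open>Independence of the representing family\<close>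

lemma hequiv_sum_eq:
  fixes F :: "'n qword \<times> 'n qword \<Rightarrow> quat \<Rightarrow> 'v::real_vector"
  assumes "hequiv p p'"
    and add: "\<And>k x y. F k (x + y) = F k x + F k y"
    and re: "\<And>a b r. (a, b) \<in> Poly_Mapping.keys p \<union> Poly_Mapping.keys p' \<Longrightarrow>
      F (a, b) (of_real r) = r *\<^sub>R G (a * b)"
  shows "(\<Sum>k\<in>Poly_Mapping.keys p. F k (Poly_Mapping.lookup p k))
       = (\<Sum>k\<in>Poly_Mapping.keys p'. F k (Poly_Mapping.lookup p' k))"
proof -
  let ?K = "Poly_Mapping.keys p \<union> Poly_Mapping.keys p'"
  let ?W = "(\<lambda>(a, b). a * b) ` ?K"
  have F0: "F k 0 = 0" for k using add[of k 0 0] by simp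
  have *: "(\<Sum>k\<in>Poly_Mapping.keys q. F k (Poly_Mapping.lookup q k))
      = (\<Sum>k\<in>?K. F k (qim (Poly_Mapping.lookup q k))) + (\<Sum>w\<in>?W. real_part q w *\<^sub>R G w)"
    if q: "Poly_Mapping.keys q \<subseteq> ?K" for q
  proof -
    have "(\<Sum>k\<in>Poly_Mapping.keys q. F k (Poly_Mapping.lookup q k))
        = (\<Sum>k\<in>?K. F k (Poly_Mapping.lookup q k))"
      using q by (intro sum.mono_neutral_left) (auto simp: in_keys_iff F0)
    also have "\<dots> = (\<Sum>k\<in>?K. F k (qim (Poly_Mapping.lookup q k))
        + qre (Poly_Mapping.lookup q k) *\<^sub>R G (fst k * snd k))"
    proof (rule sum.cong)
      fix k assume k: "k \<in> ?K"
      obtain a b where ab: "k = (a, b)" by (cases k)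
      let ?c = "Poly_Mapping.lookup q k"
      have "F k ?c = F k (qim ?c + of_real (qre ?c))"
        by (simp add: qim_def)
      also have "\<dots> = F k (qim ?c) + F k (of_real (qre ?c))"
        by (rule add)
      also have "F k (of_real (qre ?c)) = qre ?c *\<^sub>R G (fst k * snd k)"
        using k by (simp add: ab re)
      finally show "F k ?c = F k (qim ?c) + qre ?c *\<^sub>R G (fst k * snd k)" .
    qed simp
    also have "\<dots> = (\<Sum>k\<in>?K. F k (qim (Poly_Mapping.lookup q k)))
        + (\<Sum>k\<in>?K. qre (Poly_Mapping.lookup q k) *\<^sub>R G (fst k * snd k))"
      by (rule sum.distrib)
    also have "(\<Sum>k\<in>?K. qre (Poly_Mapping.lookup q k) *\<^sub>R G (fst k * snd k))
        = (\<Sum>w\<in>?W. \<Sum>k | k \<in> ?K \<and> (\<lambda>(a, b). a * b) k = w.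
            qre (Poly_Mapping.lookup q k) *\<^sub>R G (fst k * snd k))"
      by (rule sum.image_gen) simp
    also have "\<dots> = (\<Sum>w\<in>?W. real_part q w *\<^sub>R G w)"
    proof (rule sum.cong)
      fix w
      have "(\<Sum>k | k \<in> ?K \<and> (\<lambda>(a, b). a * b) k = w.
            qre (Poly_Mapping.lookup q k) *\<^sub>R G (fst k * snd k))
          = (\<Sum>k | k \<in> ?K \<and> (\<lambda>(a, b). a * b) k = w. qre (Poly_Mapping.lookup q k)) *\<^sub>R G w"
        unfolding scaleR_left.sum by (intro sum.cong refl) (auto split: prod.splits)
      also have "(\<Sum>k | k \<in> ?K \<and> (\<lambda>(a, b). a * b) k = w. qre (Poly_Mapping.lookup q k))
          = (\<Sum>k | k \<in> Poly_Mapping.keys q \<and> (\<lambda>(a, b). a * b) k = w. qre (Poly_Mapping.lookup q k))"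
      proof (rule sum.mono_neutral_right)
        show "finite {k \<in> ?K. (\<lambda>(a, b). a * b) k = w}"
          by (rule finite_subset[of _ ?K]) auto
      qed (use q in \<open>auto simp: in_keys_iff\<close>)
      also have "\<dots> = real_part q w"
        unfolding real_part_def by (rule sum.cong) auto
      finally show "(\<Sum>k | k \<in> ?K \<and> (\<lambda>(a, b). a * b) k = w.
            qre (Poly_Mapping.lookup q k) *\<^sub>R G (fst k * snd k)) = real_part q w *\<^sub>R G w" .
    qed simp
    finally show ?thesis .
  qed
  have "qim (Poly_Mapping.lookup p k) = qim (Poly_Mapping.lookup p' k)" for k
    using assms(1) by (cases k) (simp add: hequiv_def)
  moreover have "real_part p w = real_part p' w" for w
    using assms(1) by (simp add: hequiv_def)
  ultimately show ?thesis by (simp add: *)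
qed

theorem heval_hequiv: "hequiv p p' \<Longrightarrow> heval p x = heval p' x"
  unfolding heval_def case_prod_beta prod.collapse
  by (rule hequiv_sum_eq[where F = "\<lambda>k c. weval x (fst k) * c * weval x (snd k)" and G = "weval x"])
    (auto simp: algebra_simps of_real_def)

theorem riesz_re_hequiv:
  assumes "hequiv p p'" "hdeg p \<le> t" "hdeg p' \<le> t"
    and cyc: "\<And>u v. u \<in> words t \<Longrightarrow> v \<in> words t \<Longrightarrow> cyc_equiv u v \<Longrightarrow> qre (y u) = qre (y v)"
  shows "riesz_re y p = riesz_re y p'"
  unfolding riesz_re_def case_prod_beta prod.collapse qparts_sum
proof (rule hequiv_sum_eq[where F = "\<lambda>k c. qre (c * y (snd k * fst k))" and G = "\<lambda>w. qre (y w)"])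
  fix a b r assume k: "(a, b) \<in> Poly_Mapping.keys p \<union> Poly_Mapping.keys p'"
  have "wlen a + wlen b \<le> t"
    using k assms(2,3) by (force simp: hdeg_def)
  then have "qre (y (b * a)) = qre (y (a * b))"
    by (intro cyc) (auto simp: words_def cyc_equiv_def)
  then show "qre (of_real r * y (snd (a, b) * fst (a, b))) = r *\<^sub>R qre (y (a * b))"
    by simp
qed (auto simp: distrib_right intro: assms(1))

lemma heval_add: "heval (p + q) x = heval p x + heval q x"
proof -
  have *: "heval r x = (\<Sum>(a, b)\<in>Poly_Mapping.keys p \<union> Poly_Mapping.keys q.
      weval x a * Poly_Mapping.lookup r (a, b) * weval x b)"
    if "Poly_Mapping.keys r \<subseteq> Poly_Mapping.keys p \<union> Poly_Mapping.keys q" for r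
    unfolding heval_def using that by (intro sum.mono_neutral_left) (auto simp: in_keys_iff)
  show ?thesis
    using Poly_Mapping.keys_add[of p q]
    by (simp add: * lookup_add case_prod_beta distrib_left distrib_right sum.distrib)
qed

theorem heval_hstar: "heval (hstar p) x = qcnj (heval p x)"
proof -
  have zero: "heval 0 x = 0" by (simp add: heval_def)
  have sm: "heval (sum P A) x = (\<Sum>k\<in>A. heval (P k) x)" for P and A :: "('a qword \<times> 'a qword) set"
    by (induction A rule: infinite_finite_induct) (auto simp: zero heval_add)
  have sg: "heval (Poly_Mapping.single (a, b) c) x = weval x a * c * weval x b" for a b c
    by (cases "c = 0") (auto simp: heval_def)
  have cs: "qcnj (sum P A) = (\<Sum>k\<in>A. qcnj (P k))" for P and A :: "('a qword \<times> 'a qword) set"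
    by (induction A rule: infinite_finite_induct) auto
  show ?thesis
    unfolding hstar_def sm case_prod_beta sg unfolding heval_def cs case_prod_beta
    by (simp add: mult.assoc)
qed

theorem heval_real:
  assumes "hsym p"
  shows "heval p x = of_real (qre (heval p x))"
proof -
  have "heval p x = qcnj (heval p x)"
    using assms heval_hequiv[of p "hstar p" x] heval_hstar[of p x] by (simp add: hsym_def)
  then have "qre (heval p x) = qre (heval p x) \<and> qi (heval p x) = - qi (heval p x) \<and>
      qj (heval p x) = - qj (heval p x) \<and> qk (heval p x) = - qk (heval p x)"
    by (metis qcnj.sel)
  then show ?thesis by (simp add: quat_eq_iff)
qed

end

theory Submission
  imports Defs
begin

text \<open>
  Rank one and \<open>y 1 = 1\<close> force every column \<open>v\<close> of the moment matrix to be the column of the empty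
  word times \<open>y v\<close>, so \<open>y\<close> is multiplicative on products of two words of length at most \<open>d\<close>
  and hence is evaluation at \<open>first_moments y\<close>. Its localizing constraints, read at the
  empty words, say that this point is feasible. Conversely, evaluation at any feasible point is a
  feasible sequence with the same objective value, so optimality of \<open>y\<close> passes to the point.
\<close>

section \<open>Evaluation as an algebra homomorphism\<close>

lemma poly_mapping_sum_monomials:
  fixes p :: "'k \<Rightarrow>\<^sub>0 'c::comm_monoid_add"
  shows "(\<Sum>k\<in>Poly_Mapping.keys p. Poly_Mapping.single k (Poly_Mapping.lookup p k)) = p"
proof (rule poly_mapping_eqI)
  fix k
  show "Poly_Mapping.lookup (\<Sum>k\<in>Poly_Mapping.keys p.
      Poly_Mapping.single k (Poly_Mapping.lookup p k)) k = Poly_Mapping.lookup p k"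
    by (simp add: lookup_sum lookup_single when_def not_in_keys_iff_lookup_eq_zero)
qed

text \<open>Finite support makes \<open>p\<close> the sum of its monomials; the empty sum is itself
  a monomial, with coefficient \<open>0\<close>.\<close>

lemma poly_mapping_induct [case_names single add]:
  fixes p :: "'k \<Rightarrow>\<^sub>0 'c::comm_monoid_add"
  assumes single: "\<And>k c. P (Poly_Mapping.single k c)"
    and add: "\<And>p q. P p \<Longrightarrow> P q \<Longrightarrow> P (p + q)"
  shows "P p"
proof -
  have "P (sum F A)" if "\<And>k. P (F k)" for F and A :: "'k set"
    using single[of undefined 0] that by (induction A rule: infinite_finite_induct) (auto intro: add)
  then show ?thesis using single by (metis (mono_tags, lifting) poly_mapping_sum_monomials)
qed

text \<open>Cancellation can make the support of \<open>p + q\<close> smaller than the union of the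
  two supports. Since \<open>F k 0 = 0\<close>, all three sums may be taken over that union.\<close>

lemma sum_keys_add:
  fixes F :: "'k \<Rightarrow> 'c::monoid_add \<Rightarrow> 'v::comm_monoid_add"
  assumes "\<And>k. F k 0 = 0" "\<And>k x y. F k (x + y) = F k x + F k y"
  shows "(\<Sum>k\<in>Poly_Mapping.keys (p + q). F k (Poly_Mapping.lookup (p + q) k))
       = (\<Sum>k\<in>Poly_Mapping.keys p. F k (Poly_Mapping.lookup p k))
       + (\<Sum>k\<in>Poly_Mapping.keys q. F k (Poly_Mapping.lookup q k))"
proof -
  let ?K = "Poly_Mapping.keys p \<union> Poly_Mapping.keys q"
  have *: "(\<Sum>k\<in>Poly_Mapping.keys r. F k (Poly_Mapping.lookup r k))
      = (\<Sum>k\<in>?K. F k (Poly_Mapping.lookup r k))"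
    if "Poly_Mapping.keys r \<subseteq> ?K" for r
    using that by (intro sum.mono_neutral_left) (auto simp: in_keys_iff assms(1))
  show ?thesis
    unfolding *[OF Poly_Mapping.keys_add] *[OF Un_upper1] *[OF Un_upper2]
    by (simp add: lookup_add assms(2) sum.distrib)
qed

lemma reval_add: "reval (p + q) a = reval p a + reval q a"
  unfolding reval_def by (rule sum_keys_add) (simp_all add: distrib_right)

lemma reval_zero [simp]: "reval 0 a = 0"
  by (simp add: reval_def)

lemma reval_single [simp]: "reval (Poly_Mapping.single w c) a = of_real c * weval a w"
  by (cases "c = 0") (simp_all add: reval_def)

lemma reval_sum: "reval (sum P A) a = (\<Sum>k\<in>A. reval (P k) a)"
  by (induction A rule: infinite_finite_induct) (auto simp: reval_add)

lemma reval_diff: "reval (p - q) a = reval p a - reval q a"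
  using reval_add[of "p - q" q a] by simp

text \<open>Both sides are additive in each factor, so two monomials suffice; there the real
  coefficients commute past the values of the words.\<close>

lemma reval_mult: "reval (p * q) a = reval p a * reval q a"
proof (induction p rule: poly_mapping_induct)
  case (single u c)
  show ?case
  proof (induction q rule: poly_mapping_induct)
    case (single v e)
    show ?case
      by (simp add: mult_single plus_qword_def mult.assoc)
        (metis mult.assoc of_real_mult_commute_quat)
  qed (simp add: distrib_left reval_add)
qed (simp add: distrib_right reval_add)

lemma qcnj_sum: "qcnj (sum P A) = (\<Sum>k\<in>A. qcnj (P k))"
  by (induction A rule: infinite_finite_induct) auto

lemma reval_rstar: "reval (rstar p) a = qcnj (reval p a)"
  by (simp add: rstar_def reval_sum) (simp add: reval_def qcnj_sum of_real_mult_commute_quat)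

lemma quat_real_if_qcnj: "qcnj x = x \<Longrightarrow> x = of_real (qre x)"
  by (auto simp: quat_eq_iff)

lemma reval_real: "rsym p \<Longrightarrow> reval p a = of_real (qre (reval p a))"
  by (rule quat_real_if_qcnj) (metis reval_rstar rsym_def)

lemma heval_single [simp]: "heval (Poly_Mapping.single (u, v) c) a = weval a u * c * weval a v"
  by (cases "c = 0") (simp_all add: heval_def)

lemma heval_sum: "heval (sum P A) a = (\<Sum>k\<in>A. heval (P k) a)"
  by (induction A rule: infinite_finite_induct) (auto simp: heval_add, auto simp: heval_def)

lemma heval_hsandwich: "heval (hsandwich u p v) a = weval a u * heval p a * weval a v"
  unfolding hsandwich_def heval_sum
  by (simp add: case_prod_beta) (simp add: heval_def case_prod_beta sum_distrib_left sum_distrib_right mult.assoc)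


section \<open>Riesz functionals of evaluation sequences\<close>

lemma riesz_mon [simp]: "riesz y (mon w) = y w"
  by (simp add: riesz_def)

lemma riesz_weval: "riesz (weval a) p = reval p a"
  by (simp add: riesz_def reval_def)

lemma moment_matrix_eq: "moment_matrix y u v = y (wstar u * v)"
  by (simp add: moment_matrix_def mult_single plus_qword_def)

text \<open>The real part is a trace on the quaternions. This is why evaluation sequences satisfy
  the cyclic constraints and why the order \<open>b * a\<close> in \<open>riesz_re\<close> fits
  evaluation.\<close>

lemma qre_mult_commute: "qre (x * y) = qre (y * x)"
  by (simp add: mult.commute)

lemma riesz_re_weval: "riesz_re (weval a) p = qre (heval p a)"
  unfolding riesz_re_def heval_def qparts_sum case_prod_beta
proof (rule sum.cong)
  fix k
  show "qre (Poly_Mapping.lookup p (fst k, snd k) * weval a (snd k * fst k))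
      = qre (weval a (fst k) * Poly_Mapping.lookup p (fst k, snd k) * weval a (snd k))"
    \<comment> \<open>Rotating the left word to the right end under the real part yields the value
      of \<open>snd k * fst k\<close>.\<close>
    using qre_mult_commute[of "weval a (fst k)" "Poly_Mapping.lookup p k * weval a (snd k)"]
    by (simp add: mult.assoc del: times_quat.sel)
qed simp

lemma wlen_le_rdeg: "w \<in> Poly_Mapping.keys p \<Longrightarrow> wlen w \<le> rdeg p"
  by (simp add: rdeg_def)

lemma wlen_le_hdeg: "(u, v) \<in> Poly_Mapping.keys p \<Longrightarrow> wlen u + wlen v \<le> hdeg p"
  unfolding hdeg_def by (rule Max_ge) force+

lemma riesz_dirac:
  assumes "dirac_represents d a y" "rdeg p \<le> 2 * d"
  shows "riesz y p = reval p a"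
proof -
  have "y w = weval a w" if "w \<in> Poly_Mapping.keys p" for w
    using assms wlen_le_rdeg[OF that] by (simp add: dirac_represents_def words_def)
  then show ?thesis by (simp add: riesz_def reval_def)
qed

lemma riesz_re_dirac:
  assumes "dirac_represents d a y" "hdeg p \<le> 2 * d"
  shows "riesz_re y p = qre (heval p a)"
proof -
  have "y (v * u) = weval a (v * u)" if "(u, v) \<in> Poly_Mapping.keys p" for u v
    using assms wlen_le_hdeg[OF that] by (simp add: dirac_represents_def words_def)
  then have "riesz_re y p = riesz_re (weval a) p"
    unfolding riesz_re_def
    by (intro arg_cong[of _ _ qre] sum.cong refl) (auto simp del: weval_simps)
  then show ?thesis by (simp add: riesz_re_weval)
qed


section \<open>Evaluation sequences are feasible\<close>

lemma qre_norm_nonneg: "0 \<le> qre (qcnj z * z)"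
  by (simp only: mult_qcnj qparts_of_real) (simp add: qnorm2_def)

lemma sum_gram:
  "(\<Sum>u\<in>S. \<Sum>v\<in>S. qcnj (z u) * z v) = qcnj (\<Sum>u\<in>S. z u) * (\<Sum>v\<in>S. z v)"
  by (simp add: qcnj_sum sum_product)

text \<open>A scaled Gram matrix: its quadratic form at \<open>x\<close> is \<open>r\<close> times
  the squared norm of the sum of all \<open>w u * x u\<close>.\<close>

lemma quat_psd_gram:
  assumes "0 \<le> r" "\<And>u v. M u v = of_real r * (qcnj (w u) * w v)"
  shows "quat_psd S M"
  unfolding quat_psd_def
proof (intro conjI ballI allI)
  fix u v show "M u v = qcnj (M v u)"
    by (simp add: assms(2) of_real_mult_commute_quat)
next
  fix x :: "'a \<Rightarrow> quat"
  have "qcnj (x u) * M u v * x v = of_real r * (qcnj (w u * x u) * (w v * x v))" for u v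
    by (simp add: assms(2) mult.assoc) (metis mult.assoc of_real_mult_commute_quat)
  then have "(\<Sum>u\<in>S. \<Sum>v\<in>S. qcnj (x u) * M u v * x v)
      = of_real r * (\<Sum>u\<in>S. \<Sum>v\<in>S. qcnj (w u * x u) * (w v * x v))"
    by (simp add: sum_distrib_left del: qcnj_simps)
  also have "\<dots> = r *\<^sub>R (qcnj (\<Sum>u\<in>S. w u * x u) * (\<Sum>v\<in>S. w v * x v))"
    unfolding sum_gram by (simp add: of_real_def)
  finally show "0 \<le> qre (\<Sum>u\<in>S. \<Sum>v\<in>S. qcnj (x u) * M u v * x v)"
    using assms(1) qre_norm_nonneg by (simp del: times_quat.sel)
qed

lemma real_psd_gram:
  assumes "0 \<le> r" "\<And>u v. M u v = r * qre (qcnj (w u) * w v)"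
  shows "real_psd S M"
  unfolding real_psd_def
proof (intro conjI ballI allI)
  fix u v show "M u v = M v u"
    by (simp add: assms(2) algebra_simps)
next
  fix x :: "'a \<Rightarrow> real"
  \<comment> \<open>Real test coefficients are absorbed into the quaternions \<open>w u\<close>, so
    the form again becomes \<open>r\<close> times the squared norm of a single quaternion.\<close>
  have summand: "x u * M u v * x v = r * qre (qcnj (x u *\<^sub>R w u) * (x v *\<^sub>R w v))" for u v
    by (simp add: assms(2) algebra_simps)
  have "(\<Sum>u\<in>S. \<Sum>v\<in>S. x u * M u v * x v)
      = r * qre (\<Sum>u\<in>S. \<Sum>v\<in>S. qcnj (x u *\<^sub>R w u) * (x v *\<^sub>R w v))"
    by (simp only: summand sum_distrib_left qparts_sum)
  then show "0 \<le> (\<Sum>u\<in>S. \<Sum>v\<in>S. x u * M u v * x v)"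
    unfolding sum_gram using assms(1) qre_norm_nonneg by (simp del: times_quat.sel)
qed

lemma mom_common_weval: "mom_common d (weval a)"
  unfolding mom_common_def
proof (intro conjI ballI allI impI)
  fix u v :: "'a qword" assume "cyc_equiv u v"
  then show "qre (weval a u) = qre (weval a v)"
    by (metis cyc_equiv_def qre_mult_commute weval_simps(2))
next
  show "quat_psd (words d) (moment_matrix (weval a))"
    by (rule quat_psd_gram[of 1 _ "weval a"]) (simp_all add: moment_matrix_eq)
next
  fix i :: 'a and u v w :: "'a qword"
  let ?z = "weval a w"
  \<comment> \<open>The value of \<open>w + wstar w\<close> is real, hence central, so the
    commutator evaluates to zero.\<close>
  have "?z + qcnj ?z = of_real (2 * qre ?z)"
    by (simp add: quat_eq_iff del: of_real_mult)
  then have "reval (commutator (mon w + mon (wstar w)) (mon (wlet (Q i)))) a = 0"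
    by (simp add: commutator_def reval_diff reval_mult reval_add of_real_mult_commute_quat del: of_real_mult)
  then show "riesz (weval a)
      (mon u * commutator (mon w + mon (wstar w)) (mon (wlet (Q i))) * mon v) = 0"
    by (simp add: riesz_weval reval_mult)
qed simp_all

text \<open>A symmetric constraint has a real value at \<open>a\<close>, so it moves out of the
  middle of every localizing entry and leaves a Gram matrix scaled by a nonnegative number.\<close>

lemma weval_in_mom_H:
  assumes "\<And>i. i \<in> {1..m} \<Longrightarrow> rsym (g i)"
    and "a \<in> feasible_points m l (\<lambda>i. reval (g i)) (\<lambda>j. reval (h j))"
  shows "weval a \<in> mom_H d m l g h"
  unfolding mom_H_def
proof (intro CollectI conjI mom_common_weval ballI allI impI)
  fix i assume i: "i \<in> {1..m}"
  let ?r = "qre (reval (g i) a)"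
  have "reval (g i) a = of_real ?r" using assms(1)[OF i] by (rule reval_real)
  then show "quat_psd (words (d - nat \<lceil>real (rdeg (g i)) / 2\<rceil>)) (loc_matrix (g i) (weval a))"
    using assms(2) i
    by (intro quat_psd_gram[of ?r _ "weval a"])
      (auto simp: feasible_points_def loc_matrix_def riesz_weval reval_mult,
        metis mult.assoc of_real_mult_commute_quat)
next
  fix j u v assume "j \<in> {1..l}"
  then show "riesz (weval a) (mon u * h j * mon v) = 0"
    using assms(2) by (simp add: feasible_points_def riesz_weval reval_mult)
qed

lemma weval_in_mom_HR:
  assumes "\<And>i. i \<in> {1..m} \<Longrightarrow> hsym (g i)"
    and "a \<in> feasible_points m l (\<lambda>i. heval (g i)) (\<lambda>j. heval (h j))"
  shows "weval a \<in> mom_HR d m l g h"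
  unfolding mom_HR_def
proof (intro CollectI conjI mom_common_weval ballI allI impI)
  fix i assume i: "i \<in> {1..m}"
  let ?r = "qre (heval (g i) a)"
  have r: "heval (g i) a = of_real ?r" using assms(1)[OF i] by (rule heval_real)
  show "real_psd (words (d - nat \<lceil>real (hdeg (g i)) / 2\<rceil>)) (loc_matrix_re (g i) (weval a))"
  proof (rule real_psd_gram[of ?r _ "weval a"])
    show "0 \<le> ?r" using assms(2) i by (simp add: feasible_points_def)
    fix u v
    have "loc_matrix_re (g i) (weval a) u v = qre (qcnj (weval a u) * of_real ?r * weval a v)"
      by (simp add: loc_matrix_re_def riesz_re_weval heval_hsandwich r[symmetric] del: times_quat.sel)
    also have "qcnj (weval a u) * of_real ?r * weval a v = ?r *\<^sub>R (qcnj (weval a u) * weval a v)"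
      by (simp add: of_real_def)
    finally show "loc_matrix_re (g i) (weval a) u v = ?r * qre (qcnj (weval a u) * weval a v)"
      by simp
  qed
next
  fix j u v assume "j \<in> {1..l}"
  then show "riesz_re (weval a) (hsandwich u (h j) v) = 0"
    using assms(2) by (simp add: feasible_points_def riesz_re_weval heval_hsandwich)
qed


section \<open>Rank one\<close>

text \<open>Rank one makes the columns \<open>s\<close> and \<open>v\<close> right dependent. The
  pivot \<open>1\<close> in row \<open>s\<close> fixes the relation up to a right factor, and the
  other rows then give the factorization.\<close>

lemma rank_one_columns:
  assumes fin: "finite S" and rank: "quat_rank S M = 1"
    and S: "s \<in> S" "v \<in> S" and pivot: "M s s = 1" and u: "u \<in> S"
  shows "M u v = M u s * M s v"
proof (cases "v = s")
  case False
  let ?R = "{card C | C. C \<subseteq> S \<and> right_indep_columns S M C}"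
  \<comment> \<open>Finiteness makes \<open>Max\<close> a true upper bound, so an independent pair
    of columns would contradict the rank.\<close>
  have "finite ?R" using fin by simp
  then have "card {s, v} \<notin> ?R"
    using rank Max_ge[of ?R "card {s, v}"] False by (auto simp: quat_rank_def)
  then have "\<not> right_indep_columns S M {s, v}" using S by blast
  then obtain c where c: "\<And>u. u \<in> S \<Longrightarrow> M u s * c s + M u v * c v = 0"
    and nz: "c s \<noteq> 0 \<or> c v \<noteq> 0"
    using False by (auto simp: right_indep_columns_def)
  have cs: "c s = - (M s v * c v)" using c[OF S(1)] pivot by (simp add: eq_neg_iff_add_eq_0)
  \<comment> \<open>If \<open>c v\<close> vanished, so would \<open>c s\<close>; hence
    \<open>c v\<close> is nonzero and cancels on the right.\<close>
  with nz have "c v \<noteq> 0" by auto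
  moreover have "(M u v - M u s * M s v) * c v = 0"
    using c[OF u] by (simp add: cs algebra_simps)
  ultimately show ?thesis by simp
qed (simp add: pivot)

text \<open>Any representing string can be cut after its first \<open>s\<close> letters.\<close>

lemma qword_split:
  assumes "wlen w \<le> s + t"
  obtains u v where "w = u * v" "wlen u \<le> s" "wlen v \<le> t"
  using assms
proof (transfer fixing: s t thesis)
  fix w :: "'a letter list"
  assume "\<And>u v. word_eq w (u @ v) \<Longrightarrow> length u \<le> s \<Longrightarrow> length v \<le> t \<Longrightarrow> thesis"
    and "length w \<le> s + t"
  from this(1)[of "take s w" "drop s w"] this(2) show thesis by simp
qed

lemma qword_induct [case_names one letter]:
  assumes "P 1" "\<And>x w. P w \<Longrightarrow> P (wlet x * w)"
  shows "P w"
proof -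
  have "P (abs_qword xs)" for xs
  proof (induction xs)
    case Nil
    show ?case using assms(1) by (simp add: one_qword_def)
  next
    case (Cons x xs)
    then show ?case using assms(2)[of "abs_qword xs" x] by (simp add: wlet.abs_eq times_qword.abs_eq)
  qed
  then show ?thesis by (metis Quotient3_qword Quotient3_abs_rep)
qed

theorem rank_one_dirac:
  fixes y :: "'n::finite qword \<Rightarrow> quat"
  assumes "1 \<le> d" "mom_common d y" "quat_rank (words d) (moment_matrix y) = 1"
  shows "dirac_represents d (first_moments y) y"
proof -
  let ?a = "first_moments y"
  have one: "y 1 = 1" using assms(2) by (simp add: mom_common_def)
  have star: "y (wstar w) = qcnj (y w)" if "wlen w \<le> 2 * d" for w
    using assms(2) that unfolding mom_common_def words_def by (metis mem_Collect_eq qcnj_simps(3))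
  \<comment> \<open>The matrix entry in row \<open>wstar u\<close> and column \<open>v\<close> is
    \<open>y (u * v)\<close>; the pivot is the entry \<open>y 1 = 1\<close> at the empty
    word.\<close>
  have mult: "y (u * v) = y u * y v" if "wlen u \<le> d" "wlen v \<le> d" for u v
    using rank_one_columns[OF finite_words assms(3), of 1 v "wstar u"] that
    by (simp add: moment_matrix_eq one words_def)
  \<comment> \<open>The first moments fix the letters \<open>Q i\<close> by definition; the symmetry
    \<open>star\<close> carries this over to \<open>Qbar i\<close>.\<close>
  have letter: "y (wlet x) = leval ?a x" for x
    using star[of "wlet (Q (lvar x))"] assms(1) by (cases x) (simp_all add: first_moments_def)
  have short: "y w = weval ?a w" if "wlen w \<le> d" for w
    using that by (induction w rule: qword_induct) (auto simp: one mult letter assms(1))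
  \<comment> \<open>Multiplicativity is available only for factors of length at most
    \<open>d\<close>, which is just enough to cut a word of length up to \<open>2 * d\<close> in
    two.\<close>
  have "y w = weval ?a w" if w: "wlen w \<le> 2 * d" for w
  proof -
    obtain u v where "w = u * v" "wlen u \<le> d" "wlen v \<le> d"
      using qword_split[OF w[unfolded mult_2]] by blast
    then show ?thesis by (simp add: mult short)
  qed
  then show ?thesis by (simp add: dirac_represents_def words_def)
qed


section \<open>Tightness\<close>

lemma quat_psd_diagonal:
  assumes "quat_psd S M" "finite S" "s \<in> S"
  shows "0 \<le> qre (M s s)"
proof -
  \<comment> \<open>The unit vector at \<open>s\<close> isolates the diagonal entry.\<close>
  let ?x = "\<lambda>u. if u = s then 1 else 0"
  have "(\<Sum>u\<in>S. \<Sum>v\<in>S. qcnj (?x u) * M u v * ?x v)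
      = (\<Sum>u\<in>S. if u = s then (\<Sum>v\<in>S. if v = s then M s v else 0) else 0)"
    by (intro sum.cong refl) (auto intro: sum.cong)
  also have "\<dots> = M s s" using assms(2,3) by simp
  finally have eq: "(\<Sum>u\<in>S. \<Sum>v\<in>S. qcnj (?x u) * M u v * ?x v) = M s s" .
  have "0 \<le> qre (\<Sum>u\<in>S. \<Sum>v\<in>S. qcnj (?x u) * M u v * ?x v)"
    using assms(1) unfolding quat_psd_def by (elim conjE allE[of _ ?x])
  then show ?thesis unfolding eq .
qed

lemma real_psd_diagonal:
  assumes "real_psd S M" "finite S" "s \<in> S"
  shows "0 \<le> M s s"
proof -
  let ?x = "\<lambda>u. if u = s then 1 else 0"
  have "(\<Sum>u\<in>S. \<Sum>v\<in>S. ?x u * M u v * ?x v)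
      = (\<Sum>u\<in>S. if u = s then (\<Sum>v\<in>S. if v = s then M s v else 0) else 0)"
    by (intro sum.cong refl) (auto intro: sum.cong)
  also have "\<dots> = M s s" using assms(2,3) by simp
  finally have eq: "(\<Sum>u\<in>S. \<Sum>v\<in>S. ?x u * M u v * ?x v) = M s s" .
  have "0 \<le> (\<Sum>u\<in>S. \<Sum>v\<in>S. ?x u * M u v * ?x v)"
    using assms(1) unfolding real_psd_def by (elim conjE allE[of _ ?x])
  then show ?thesis unfolding eq .
qed

lemma hsandwich_one [simp]: "hsandwich 1 p 1 = p"
  unfolding hsandwich_def by (simp add: case_prod_beta poly_mapping_sum_monomials)

text \<open>The empty word belongs to every \<open>words t\<close>, so each localizing matrix has a
  diagonal entry \<open>riesz y (g i)\<close>, which is the value of \<open>g i\<close> at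
  \<open>a\<close>. The equality constraints are likewise read with both outer words empty.\<close>

lemma mom_H_point_feasible:
  assumes y: "y \<in> mom_H d m l g h" and rep: "dirac_represents d a y"
    and "\<And>i. i \<in> {1..m} \<Longrightarrow> rdeg (g i) \<le> 2 * d" "\<And>j. j \<in> {1..l} \<Longrightarrow> rdeg (h j) \<le> 2 * d"
  shows "a \<in> feasible_points m l (\<lambda>i. reval (g i)) (\<lambda>j. reval (h j))"
  unfolding feasible_points_def
proof (intro CollectI conjI ballI)
  \<comment> \<open>The polynomial product uses the additive copy of the word monoid, whose neutral
    element \<open>0\<close> is the empty word.\<close>
  have mon_one: "mon 1 = (1 :: 'a rpoly)" by (simp flip: zero_qword_def)
  { fix i assume i: "i \<in> {1..m}"
    then have "0 \<le> qre (loc_matrix (g i) y 1 1)"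
      using y by (intro quat_psd_diagonal[OF _ finite_words]) (auto simp: mom_H_def words_def)
    then show "0 \<le> qre (reval (g i) a)"
      using riesz_dirac[OF rep assms(3)[OF i]] by (simp add: loc_matrix_def mon_one) }
  { fix j assume j: "j \<in> {1..l}"
    then have "riesz y (mon 1 * h j * mon 1) = 0"
      using y unfolding mom_H_def by auto
    then show "reval (h j) a = 0"
      using riesz_dirac[OF rep assms(4)[OF j]] by (simp add: mon_one) }
qed

lemma mom_HR_point_feasible:
  assumes y: "y \<in> mom_HR d m l g h" and rep: "dirac_represents d a y"
    and "\<And>i. i \<in> {1..m} \<Longrightarrow> hdeg (g i) \<le> 2 * d"
    and "\<And>j. j \<in> {1..l} \<Longrightarrow> hsym (h j) \<and> hdeg (h j) \<le> 2 * d"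
  shows "a \<in> feasible_points m l (\<lambda>i. heval (g i)) (\<lambda>j. heval (h j))"
  unfolding feasible_points_def
proof (intro CollectI conjI ballI)
  fix i assume i: "i \<in> {1..m}"
  then have "0 \<le> loc_matrix_re (g i) y 1 1"
    using y by (intro real_psd_diagonal[OF _ finite_words]) (auto simp: mom_HR_def words_def)
  then show "0 \<le> qre (heval (g i) a)"
    using riesz_re_dirac[OF rep assms(3)[OF i]] by (simp add: loc_matrix_re_def)
next
  fix j assume j: "j \<in> {1..l}"
  then have "riesz_re y (hsandwich 1 (h j) 1) = 0"
    using y unfolding mom_HR_def by (auto simp del: hsandwich_one)
  then have "qre (heval (h j) a) = 0"
    using riesz_re_dirac[OF rep] assms(4)[OF j] by simp
  \<comment> \<open>The relaxation controls only the real part of the value; symmetry of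
    \<open>h j\<close> makes that the whole value.\<close>
  then show "heval (h j) a = 0"
    using heval_real[of "h j" a] assms(4)[OF j] by simp
qed

lemma optimal_value_eq: "optimal_solution S F x \<Longrightarrow> optimal_value S F = ereal (F x)"
  unfolding optimal_value_def optimal_solution_def
  by (intro antisym INF_lower INF_greatest) auto

text \<open>Each \<open>b\<close> in \<open>K\<close> yields the competitor \<open>weval b\<close>
  with objective value \<open>f(b)\<close>, while \<open>y\<close> itself has value
  \<open>f(a)\<close>. Keeping \<open>S\<close> and \<open>K\<close> abstract serves both
  relaxations.\<close>

lemma tight_of_dirac:
  assumes opt: "optimal_solution S (\<lambda>z. riesz_re z f) y"
    and rep: "dirac_represents d a y" and deg: "hdeg f \<le> 2 * d"
    and "a \<in> K" and "\<And>b. b \<in> K \<Longrightarrow> weval b \<in> S"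
  shows "optimal_value S (\<lambda>z. riesz_re z f) = optimal_value K (\<lambda>b. qre (heval f b))"
    and "optimal_solution K (\<lambda>b. qre (heval f b)) a"
proof -
  have val: "riesz_re y f = qre (heval f a)" using rep deg by (rule riesz_re_dirac)
  show *: "optimal_solution K (\<lambda>b. qre (heval f b)) a"
    unfolding optimal_solution_def
  proof (intro conjI ballI)
    fix b assume "b \<in> K"
    then have "riesz_re y f \<le> riesz_re (weval b) f"
      using opt assms(5) by (simp add: optimal_solution_def)
    then show "qre (heval f a) \<le> qre (heval f b)" by (simp add: val riesz_re_weval)
  qed (rule assms(4))
  \<comment> \<open>Both infima are attained, at \<open>y\<close> and at \<open>a\<close>, with the
    same value.\<close>
  show "optimal_value S (\<lambda>z. riesz_re z f) = optimal_value K (\<lambda>b. qre (heval f b))"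
    by (simp add: optimal_value_eq[OF opt] optimal_value_eq[OF *] val)
qed

theorem theorem6p7:
  fixes d m l :: nat
    and f :: "'n::finite hpoly"
    and y :: "'n qword \<Rightarrow> quat"
  assumes "1 \<le> d"
    and "hsym f"
    and "hdeg f \<le> 2 * d"
    and "quat_rank (words d) (moment_matrix y) = 1"
  shows
    "(\<forall>g h :: nat \<Rightarrow> 'n rpoly.
        (\<forall>i\<in>{1..m}. rsym (g i) \<and> rdeg (g i) \<le> 2 * d) \<longrightarrow>
        (\<forall>j\<in>{1..l}. rdeg (h j) \<le> 2 * d) \<longrightarrow>
        optimal_solution (mom_H d m l g h) (\<lambda>z. riesz_re z f) y \<longrightarrow>
        (let K = feasible_points m l (\<lambda>i. reval (g i)) (\<lambda>j. reval (h j)) in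
           optimal_value (mom_H d m l g h) (\<lambda>z. riesz_re z f) = optimal_value K (\<lambda>a. qre (heval f a)) \<and>
           optimal_solution K (\<lambda>a. qre (heval f a)) (first_moments y) \<and>
           dirac_represents d (first_moments y) y))
     \<and>
     (\<forall>g h :: nat \<Rightarrow> 'n hpoly.
        (\<forall>i\<in>{1..m}. hsym (g i) \<and> hdeg (g i) \<le> 2 * d) \<longrightarrow>
        (\<forall>j\<in>{1..l}. hsym (h j) \<and> hdeg (h j) \<le> 2 * d) \<longrightarrow>
        optimal_solution (mom_HR d m l g h) (\<lambda>z. riesz_re z f) y \<longrightarrow>
        (let K = feasible_points m l (\<lambda>i. heval (g i)) (\<lambda>j. heval (h j)) in
           optimal_value (mom_HR d m l g h) (\<lambda>z. riesz_re z f) = optimal_value K (\<lambda>a. qre (heval f a)) \<and>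
           optimal_solution K (\<lambda>a. qre (heval f a)) (first_moments y) \<and>
           dirac_represents d (first_moments y) y))"
proof (intro conjI allI impI)
  fix g h :: "nat \<Rightarrow> 'n rpoly"
  assume g: "\<forall>i\<in>{1..m}. rsym (g i) \<and> rdeg (g i) \<le> 2 * d"
    and h: "\<forall>j\<in>{1..l}. rdeg (h j) \<le> 2 * d"
    and opt: "optimal_solution (mom_H d m l g h) (\<lambda>z. riesz_re z f) y"
  have y: "y \<in> mom_H d m l g h" using opt by (simp add: optimal_solution_def)
  then have rep: "dirac_represents d (first_moments y) y"
    using assms(1,4) by (intro rank_one_dirac) (auto simp: mom_H_def)
  \<comment> \<open>The two inputs specific to this relaxation: the represented point is feasible,
    and evaluations at feasible points are feasible sequences.\<close>
  note tight = tight_of_dirac[OF opt rep assms(3) mom_H_point_feasible[OF y rep] weval_in_mom_H]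
  show "let K = feasible_points m l (\<lambda>i. reval (g i)) (\<lambda>j. reval (h j)) in
      optimal_value (mom_H d m l g h) (\<lambda>z. riesz_re z f) = optimal_value K (\<lambda>a. qre (heval f a)) \<and>
      optimal_solution K (\<lambda>a. qre (heval f a)) (first_moments y) \<and>
      dirac_represents d (first_moments y) y"
    unfolding Let_def using g h by (intro conjI tight rep) auto
next
  fix g h :: "nat \<Rightarrow> 'n hpoly"
  assume g: "\<forall>i\<in>{1..m}. hsym (g i) \<and> hdeg (g i) \<le> 2 * d"
    and h: "\<forall>j\<in>{1..l}. hsym (h j) \<and> hdeg (h j) \<le> 2 * d"
    and opt: "optimal_solution (mom_HR d m l g h) (\<lambda>z. riesz_re z f) y"
  have y: "y \<in> mom_HR d m l g h" using opt by (simp add: optimal_solution_def)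
  then have rep: "dirac_represents d (first_moments y) y"
    using assms(1,4) by (intro rank_one_dirac) (auto simp: mom_HR_def)
  note tight = tight_of_dirac[OF opt rep assms(3) mom_HR_point_feasible[OF y rep] weval_in_mom_HR]
  show "let K = feasible_points m l (\<lambda>i. heval (g i)) (\<lambda>j. heval (h j)) in
      optimal_value (mom_HR d m l g h) (\<lambda>z. riesz_re z f) = optimal_value K (\<lambda>a. qre (heval f a)) \<and>
      optimal_solution K (\<lambda>a. qre (heval f a)) (first_moments y) \<and>
      dirac_represents d (first_moments y) y"
    unfolding Let_def using g h by (intro conjI tight rep) auto
qed

end
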